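(* Let $c\in\mathbb R^n_+$, $w>0$, $\sigma>0$, and consider the barrier-regularized linear logarithmic utility maximization problem $$f^\sigma(p)=\max_{x\in\mathbb R^n_+}\ -v^\sigma(x):=\log(\langle c,x\rangle)+\sigma\langle\log(x),\mathbf 1\rangle\quad\text{s.t. }\langle p,x\rangle\le w,$$ with solution $x(p)$ (the best response). Then the negative logarithmic utility $v^\sigma$, the dual function $f^\sigma$, and the best-response mapping $p\mapsto x(p)$ are scaled Lipschitz continuous (SLC).
   Context: Notation: $\log(x)$ is taken entrywise, $\mathbf 1$ is the all-ones vector, $c\ne0$ so that $\log\langle c,x\rangle$ is meaningful. For $y>0$ in $\mathbb R^n$ and $h\in\mathbb R^n$, $\|h\|_y=\|\mathrm{diag}(y)^{-1}h\|$ (Euclidean norm). SLC of a function $g$ on the positive orthant: there is a finite constant $T$ such that for all $y>0$ and all $h\in\mathbb R^n$ with $\rho=\|h\|_y<1$, $$\big|g(y+h)-g(y)-\nabla g(y)[h]-\tfrac12\nabla^2g(y)[h,h]\big|\le\frac{T\rho^3}{6(1-\rho)}.$$ SLC of the mapping $x(\cdot)$: there is a finite constant $T'$ such that for all $p>0$ and $q\in\mathbb R^n$ with $\varrho=\|q\|_p<1$, $$\|\mathrm{diag}(p)\,(x(p+q)-x(p)-\nabla x(p)[q])\|\le\frac{T'\varrho^2}{2(1-\varrho)}.$$ *)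

theory Defs
  imports "HOL-Analysis.Analysis"
begin

(* The orders 0 \<le> x, 0 < x on real ^ 'n are avoided: the library's strict order there is
   "componentwise \<le> and not equal", which is weaker than strict positivity of all entries. *)

definition nonneg_orthant :: "(real ^ 'n) set" where
  "nonneg_orthant = {x. \<forall>i. 0 \<le> x $ i}"

definition pos_orthant :: "(real ^ 'n) set" where
  "pos_orthant = {x. \<forall>i. 0 < x $ i}"

(* \<parallel>h\<parallel>_y = \<parallel>diag(y)^{-1} h\<parallel>, meaningful for y in the positive orthant. *)
definition local_norm :: "real ^ 'n \<Rightarrow> real ^ 'n \<Rightarrow> real" where
  "local_norm y h = norm (\<chi> i. h $ i / y $ i)"

(* G and H are the gradient and the Hessian of g on the positive orthant; they are determined
   there by the derivative conditions because the orthant is open. The (twice) differentiability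
   that the notation \<nabla>g, \<nabla>^2 g presupposes is part of the definition.
   local_norm y h < 1 forces y + h to stay in the orthant. *)
definition SLC_function :: "(real ^ 'n \<Rightarrow> real) \<Rightarrow> bool" where
  "SLC_function g \<longleftrightarrow>
    (\<exists>(G :: real ^ 'n \<Rightarrow> real ^ 'n) (H :: real ^ 'n \<Rightarrow> real ^ 'n ^ 'n).
      (\<forall>y \<in> pos_orthant. GDERIV g y :> G y \<and> (G has_derivative (\<lambda>h. H y *v h)) (at y)) \<and>
      (\<exists>T. \<forall>y \<in> pos_orthant. \<forall>h. local_norm y h < 1 \<longrightarrow>
        \<bar>g (y + h) - g y - G y \<bullet> h - (1 / 2) * (h \<bullet> (H y *v h))\<bar>
          \<le> T * local_norm y h ^ 3 / (6 * (1 - local_norm y h))))"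

(* J is the Jacobian of x; the vector (\<chi> i. p $ i * v $ i) is diag(p) v. *)
definition SLC_mapping :: "(real ^ 'n \<Rightarrow> real ^ 'n) \<Rightarrow> bool" where
  "SLC_mapping x \<longleftrightarrow>
    (\<exists>J :: real ^ 'n \<Rightarrow> real ^ 'n ^ 'n.
      (\<forall>p \<in> pos_orthant. (x has_derivative (\<lambda>q. J p *v q)) (at p)) \<and>
      (\<exists>T. \<forall>p \<in> pos_orthant. \<forall>q. local_norm p q < 1 \<longrightarrow>
        norm (\<chi> i. p $ i * (x (p + q) - x p - J p *v q) $ i)
          \<le> T * local_norm p q ^ 2 / (2 * (1 - local_norm p q))))"

(* v^\<sigma>, to be used on the positive orthant only (ln is total in HOL). *)
definition neg_log_utility :: "real ^ 'n \<Rightarrow> real \<Rightarrow> real ^ 'n \<Rightarrow> real" where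
  "neg_log_utility c \<sigma> x = - (ln (c \<bullet> x) + \<sigma> * ((\<chi> i. ln (x $ i)) \<bullet> 1))"

(* -v^\<sigma> on the closed orthant with the convention log 0 = -\<infinity>: since \<sigma> > 0, a single vanishing
   entry of x makes the whole objective -\<infinity>. *)
definition utility_objective :: "real ^ 'n \<Rightarrow> real \<Rightarrow> real ^ 'n \<Rightarrow> ereal" where
  "utility_objective c \<sigma> x =
    (if x \<in> pos_orthant then ereal (- neg_log_utility c \<sigma> x) else -\<infinity>)"

definition budget_set :: "real \<Rightarrow> real ^ 'n \<Rightarrow> (real ^ 'n) set" where
  "budget_set w p = {x \<in> nonneg_orthant. p \<bullet> x \<le> w}"

definition dual_function :: "real ^ 'n \<Rightarrow> real \<Rightarrow> real \<Rightarrow> real ^ 'n \<Rightarrow> real" where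
  "dual_function c \<sigma> w p =
    real_of_ereal (SUP x \<in> budget_set w p. utility_objective c \<sigma> x)"

definition best_response :: "real ^ 'n \<Rightarrow> real \<Rightarrow> real \<Rightarrow> real ^ 'n \<Rightarrow> real ^ 'n" where
  "best_response c \<sigma> w p = arg_max_on (utility_objective c \<sigma>) (budget_set w p)"

end

theory Submission
  imports Defs
begin

text \<open>
  Everything reduces to two mappings that are inverse to each other up to a constant: the marginal
  utility \<open>m(x) = - \<nabla>v(x)\<close>, with entries \<open>c\<^sub>i / \<langle>c, x\<rangle> + \<sigma> / x\<^sub>i\<close>, and the best
  response. Since \<open>\<langle>x, m(x)\<rangle> = 1 + n\<sigma>\<close> for every \<open>x\<close>, the optimality condition
  \<open>m(x) = \<mu> p\<close> can hold on the budget line \<open>\<langle>p, x\<rangle> = w\<close> only with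
  \<open>\<mu> = (1 + n\<sigma>) / w\<close>, and then it does force \<open>x\<close> onto that line. So the best response is
  \<open>x(p) = m\<^sup>-\<^sup>1(\<mu> p)\<close> with a multiplier independent of \<open>p\<close>. The gradients of \<open>v\<close> and \<open>f\<close>
  are \<open>- m\<close> and, by the envelope theorem, \<open>- \<mu> x(\<cdot>)\<close>. A function whose gradient is a scaled
  Lipschitz mapping is itself scaled Lipschitz (\<open>SLC_function_of_gradient\<close>), so it suffices to treat
  the mappings \<open>m\<close> and \<open>x(\<cdot>)\<close>.

  Both are controlled by one exact expansion. Put \<open>\<xi>\<^sub>i = h\<^sub>i / x\<^sub>i\<close> and let
  \<open>a\<^sub>i = c\<^sub>i x\<^sub>i / \<langle>c, x\<rangle>\<close>, a point of the simplex. Then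
  \<open>diag(x) (m(x + h) - m(x)) = R - A \<xi>\<close>, where \<open>A = \<sigma> I + a a\<^sup>T\<close> and \<open>R\<close> is an explicit
  nonnegative vector, quadratic in \<open>\<xi>\<close> (\<open>marginal_utility_diff\<close>). For \<open>m\<close> itself, the error is
  \<open>R\<close>, and it is estimated directly.

  For the best response, \<open>h = x(p + q) - x(p)\<close> turns the expansion into \<open>A \<xi> = y + R\<close> with
  \<open>y\<^sub>i = - \<mu> x\<^sub>i q\<^sub>i\<close>, so the linear part of \<open>\<xi>\<close> in \<open>q\<close> is \<open>A\<^sup>-\<^sup>1 y\<close> and the error is
  \<open>A\<^sup>-\<^sup>1 R\<close>. The difficulty is that \<open>\<xi>\<close> need not be small, so that a bound by local Taylor
  expansion is not available. Pairing the equation with \<open>\<xi>\<close> instead gives the energy identity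
  \<open>\<langle>\<xi>, y\<rangle> = \<Sum>\<^sub>i \<sigma> \<xi>\<^sub>i\<^sup>2 / (1 + \<xi>\<^sub>i) + \<tau>\<^sup>2 / (1 + \<tau>)\<close> with \<open>\<tau> = \<langle>a, \<xi>\<rangle>\<close>, whose right-hand
  side is also the sum of the entries of \<open>R\<close> (\<open>remainder_energy\<close>). Hence
  \<open>\<parallel>R\<parallel> \<le> \<langle>\<xi>, y\<rangle> \<le> (1 + \<sigma>) \<rho> \<parallel>\<xi>\<parallel>\<close>. The budget shares satisfy
  \<open>\<sigma> \<le> \<mu> p\<^sub>i x\<^sub>i \<le> 1 + \<sigma>\<close>, both at \<open>p\<close> and at \<open>p + q\<close>, which bounds \<open>1 + \<xi>\<^sub>i\<close> by a multiple
  of \<open>1 / (1 - \<rho>)\<close>; the same identity then bounds \<open>\<parallel>\<xi>\<parallel>\<close> by a multiple of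
  \<open>\<rho> / (1 - \<rho>)\<close>, and the two estimates together give \<open>\<parallel>R\<parallel> = O(\<rho>\<^sup>2 / (1 - \<rho>))\<close>.
\<close>

section \<open>Scaled Lipschitz continuity from quadratic remainder bounds\<close>

lemma open_pos_orthant: "open (pos_orthant :: (real ^ 'n) set)"
proof -
  have "pos_orthant = (\<Inter>i. {x :: real ^ 'n. 0 < x $ i})"
    by (auto simp: pos_orthant_def)
  also have "open \<dots>"
    by (intro open_INT ballI open_Collect_less continuous_intros) simp_all
  finally show ?thesis .
qed

lemma abs_ratio_le_local_norm: "\<bar>h $ i / y $ i\<bar> \<le> local_norm y h"
  unfolding local_norm_def
  using component_le_norm_cart[of "\<chi> i. h $ i / y $ i" i] by simp

lemma local_norm_nonneg: "0 \<le> local_norm y h"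
  by (simp add: local_norm_def)

lemma local_norm_scaleR: "local_norm y (t *\<^sub>R h) = \<bar>t\<bar> * local_norm y h"
proof -
  have "(\<chi> i. (t *\<^sub>R h) $ i / y $ i) = t *\<^sub>R (\<chi> i. h $ i / y $ i)"
    by (simp add: vec_eq_iff)
  then show ?thesis by (simp add: local_norm_def)
qed

lemma local_ball_subset_pos_orthant:
  assumes "y \<in> pos_orthant" "local_norm y h < 1"
  shows "y + h \<in> pos_orthant"
proof -
  have "0 < y $ i + h $ i" for i
  proof -
    have "y $ i > 0" using assms by (simp add: pos_orthant_def)
    moreover have "\<bar>h $ i / y $ i\<bar> < 1"
      using abs_ratio_le_local_norm[of h i y] assms by linarith
    ultimately show ?thesis by (simp add: field_simps)
  qed
  then show ?thesis by (simp add: pos_orthant_def)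
qed

text \<open>
  Differentiability comes for free: for fixed \<open>p\<close> the local norm is equivalent to the Euclidean
  norm, so the error bound is \<open>O(\<parallel>q\<parallel>\<^sup>2)\<close> near 0 and identifies the candidate linear map as the
  derivative. For the best response this replaces the implicit function theorem.
\<close>
lemma SLC_mappingI:
  fixes x :: "real ^ 'n \<Rightarrow> real ^ 'n"
  assumes lin: "\<And>p. p \<in> pos_orthant \<Longrightarrow> linear (L p)"
    and bound: "\<And>p q. \<lbrakk>p \<in> pos_orthant; local_norm p q < 1\<rbrakk> \<Longrightarrow>
      norm (\<chi> i. p $ i * (x (p + q) - x p - L p q) $ i)
        \<le> K * local_norm p q ^ 2 / (1 - local_norm p q)"
  shows "SLC_mapping x"
proof -
  have der: "(x has_derivative (L p)) (at p)" if p: "p \<in> pos_orthant" for p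
  proof -
    define m where "m = Min (range (\<lambda>i. p $ i))"
    have m: "m \<le> p $ i" for i by (auto simp: m_def)
    have m0: "m > 0" using p by (auto simp: m_def pos_orthant_def)
    have est: "norm (x (p + q) - x p - L p q) \<le> (2 * \<bar>K\<bar> / m ^ 3) * norm q ^ 2"
      if q: "norm q < m / 2" for q
    proof -
      let ?r = "local_norm p q" and ?e = "x (p + q) - x p - L p q"
      have "?r \<le> norm ((1 / m) *\<^sub>R q)"
        unfolding local_norm_def
      proof (rule norm_le_componentwise_cart)
        fix i
        have "\<bar>q $ i\<bar> / \<bar>p $ i\<bar> \<le> \<bar>q $ i\<bar> / m"
          using m[of i] m0 by (intro divide_left_mono) auto
        then show "norm ((\<chi> i. q $ i / p $ i) $ i) \<le> norm (((1 / m) *\<^sub>R q) $ i)"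
          using m0 by (simp add: abs_mult)
      qed
      then have r: "?r \<le> norm q / m" using m0 by simp
      also have "norm q / m < 1 / 2" using q m0 by (simp add: field_simps)
      finally have r2: "?r < 1 / 2" .
      have "norm (m *\<^sub>R ?e) \<le> norm (\<chi> i. p $ i * ?e $ i)"
      proof (rule norm_le_componentwise_cart)
        fix i
        show "norm ((m *\<^sub>R ?e) $ i) \<le> norm ((\<chi> i. p $ i * ?e $ i) $ i)"
          using m[of i] m0 by (simp add: abs_mult mult_right_mono)
      qed
      then have "m * norm ?e \<le> norm (\<chi> i. p $ i * ?e $ i)" using m0 by simp
      also have "\<dots> \<le> K * ?r ^ 2 / (1 - ?r)" using bound[OF p] r2 by simp
      also have "\<dots> \<le> \<bar>K\<bar> * ?r ^ 2 / (1 / 2)"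
        using r2 by (intro frac_le mult_right_mono) auto
      also have "\<dots> = 2 * \<bar>K\<bar> * ?r ^ 2" by simp
      also have "\<dots> \<le> 2 * \<bar>K\<bar> * (norm q / m) ^ 2"
        using r local_norm_nonneg[of p q] by (intro mult_left_mono power_mono) auto
      finally have "m * norm ?e \<le> 2 * \<bar>K\<bar> * (norm q / m) ^ 2" .
      then show ?thesis using m0 by (simp add: field_simps power2_eq_square power3_eq_cube)
    qed
    show ?thesis
      unfolding has_derivative_at
    proof
      show "bounded_linear (L p)" using lin[OF p] linear_conv_bounded_linear by blast
      show "(\<lambda>h. norm (x (p + h) - x p - L p h) / norm h) \<midarrow>0\<rightarrow> 0"
      proof (rule Lim_null_comparison)
        show "\<forall>\<^sub>F q in at 0. norm (norm (x (p + q) - x p - L p q) / norm q)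
                \<le> (2 * \<bar>K\<bar> / m ^ 3) * norm q"
          unfolding eventually_at
        proof (intro exI[of _ "m / 2"] conjI ballI impI)
          fix q :: "real ^ 'n"
          assume "q \<noteq> 0 \<and> dist q 0 < m / 2"
          then show "norm (norm (x (p + q) - x p - L p q) / norm q)
                \<le> (2 * \<bar>K\<bar> / m ^ 3) * norm q"
            using est[of q] m0 by (simp add: divide_le_eq power2_eq_square mult.assoc)
        qed (use m0 in auto)
        show "((\<lambda>q. (2 * \<bar>K\<bar> / m ^ 3) * norm q) \<longlongrightarrow> 0) (at 0)"
          by (intro tendsto_mult_right_zero tendsto_norm_zero tendsto_ident_at)
      qed
    qed
  qed
  have mat: "matrix (L p) *v q = L p q" if "p \<in> pos_orthant" for p q
    using lin[OF that] by simp
  show ?thesis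
    unfolding SLC_mapping_def
  proof (intro exI[of _ "\<lambda>p. matrix (L p)"] conjI exI[of _ "2 * K"] ballI allI impI)
    fix p :: "real ^ 'n" assume p: "p \<in> pos_orthant"
    show "(x has_derivative (\<lambda>q. matrix (L p) *v q)) (at p)"
      using der[OF p] mat[OF p] by simp
    fix q assume q: "local_norm p q < 1"
    have "2 * K * local_norm p q ^ 2 / (2 * (1 - local_norm p q))
        = K * local_norm p q ^ 2 / (1 - local_norm p q)"
      using q by (simp add: field_simps)
    then show "norm (\<chi> i. p $ i * (x (p + q) - x p - matrix (L p) *v q) $ i)
        \<le> 2 * K * local_norm p q ^ 2 / (2 * (1 - local_norm p q))"
      using bound[OF p q] mat[OF p] by (simp only:)
  qed
qed

lemma SLC_mapping_scaleR:
  fixes x :: "real ^ 'n \<Rightarrow> real ^ 'n"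
  assumes "SLC_mapping x"
  shows "SLC_mapping (\<lambda>p. a *\<^sub>R x p)"
proof -
  obtain J T where der: "\<And>p. p \<in> pos_orthant \<Longrightarrow> (x has_derivative (\<lambda>q. J p *v q)) (at p)"
    and bound: "\<And>p q. \<lbrakk>p \<in> pos_orthant; local_norm p q < 1\<rbrakk> \<Longrightarrow>
        norm (\<chi> i. p $ i * (x (p + q) - x p - J p *v q) $ i)
          \<le> T * local_norm p q ^ 2 / (2 * (1 - local_norm p q))"
    using assms unfolding SLC_mapping_def by blast
  show ?thesis
  proof (rule SLC_mappingI[where L = "\<lambda>p q. a *\<^sub>R (J p *v q)" and K = "\<bar>a\<bar> * T / 2"])
    fix p :: "real ^ 'n"
    show "linear (\<lambda>q. a *\<^sub>R (J p *v q))"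
      by (intro linear_compose_scale_right matrix_vector_mul_linear)
    fix q assume pq: "p \<in> pos_orthant" "local_norm p q < 1"
    have "(\<chi> i. p $ i * (a *\<^sub>R x (p + q) - a *\<^sub>R x p - a *\<^sub>R (J p *v q)) $ i)
        = a *\<^sub>R (\<chi> i. p $ i * (x (p + q) - x p - J p *v q) $ i)"
      by (simp add: vec_eq_iff algebra_simps)
    then have "norm (\<chi> i. p $ i * (a *\<^sub>R x (p + q) - a *\<^sub>R x p - a *\<^sub>R (J p *v q)) $ i)
        = \<bar>a\<bar> * norm (\<chi> i. p $ i * (x (p + q) - x p - J p *v q) $ i)" by simp
    also have "\<dots> \<le> \<bar>a\<bar> * (T * local_norm p q ^ 2 / (2 * (1 - local_norm p q)))"
      using bound[OF pq] by (intro mult_left_mono) auto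
    finally show "norm (\<chi> i. p $ i * (a *\<^sub>R x (p + q) - a *\<^sub>R x p - a *\<^sub>R (J p *v q)) $ i)
        \<le> \<bar>a\<bar> * T / 2 * local_norm p q ^ 2 / (1 - local_norm p q)"
      by (simp add: mult.assoc)
  qed
qed

text \<open>The local norm at \<open>y\<close> is dual to \<open>v \<mapsto> \<parallel>diag(y) v\<parallel>\<close>, the norm that measures the error of a mapping.\<close>
lemma abs_inner_le_local_norm:
  assumes "y \<in> pos_orthant"
  shows "\<bar>v \<bullet> h\<bar> \<le> norm (\<chi> i. y $ i * v $ i) * local_norm y h"
proof -
  have "v \<bullet> h = (\<chi> i. y $ i * v $ i) \<bullet> (\<chi> i. h $ i / y $ i)"
    using assms unfolding inner_vec_def pos_orthant_def
    by (intro sum.cong) (auto simp: less_imp_neq[symmetric])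
  then show ?thesis by (simp add: local_norm_def Cauchy_Schwarz_ineq2)
qed

text \<open>
  The second-order Taylor error of \<open>g\<close> along the segment from \<open>y\<close> to \<open>y + h\<close> has as its derivative
  the first-order error of \<open>G\<close>, paired with \<open>h\<close>. The mean value theorem and duality of the
  norms turn the quadratic bound for \<open>G\<close> into a cubic one. Integrating instead would save the
  factor 3 in the constant.
\<close>
lemma SLC_function_of_gradient:
  fixes g :: "real ^ 'n \<Rightarrow> real"
  assumes grad: "\<And>y. y \<in> pos_orthant \<Longrightarrow> GDERIV g y :> G y"
    and SLC: "SLC_mapping G"
  shows "SLC_function g"
proof -
  obtain H T where der: "\<And>p. p \<in> pos_orthant \<Longrightarrow> (G has_derivative (\<lambda>q. H p *v q)) (at p)"
    and bound: "\<And>p q. \<lbrakk>p \<in> pos_orthant; local_norm p q < 1\<rbrakk> \<Longrightarrow>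
        norm (\<chi> i. p $ i * (G (p + q) - G p - H p *v q) $ i)
          \<le> T * local_norm p q ^ 2 / (2 * (1 - local_norm p q))"
    using SLC unfolding SLC_mapping_def by blast
  have "\<bar>g (y + h) - g y - G y \<bullet> h - (1 / 2) * (h \<bullet> (H y *v h))\<bar>
          \<le> (3 * \<bar>T\<bar>) * local_norm y h ^ 3 / (6 * (1 - local_norm y h))"
    if y: "y \<in> pos_orthant" and h: "local_norm y h < 1" for y h
  proof -
    let ?r = "local_norm y h"
    let ?e = "\<lambda>t. G (y + t *\<^sub>R h) - G y - H y *v (t *\<^sub>R h)"
    define \<phi> where "\<phi> t = g (y + t *\<^sub>R h) - t * (G y \<bullet> h) - t ^ 2 / 2 * (h \<bullet> (H y *v h))" for t
    have r0: "?r \<ge> 0" by (rule local_norm_nonneg)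
    have tr: "local_norm y (t *\<^sub>R h) \<le> ?r" if "0 \<le> t" "t \<le> 1" for t
      using that r0 by (simp add: local_norm_scaleR mult_left_le_one_le)
    have "(\<phi> has_real_derivative ?e t \<bullet> h) (at t)" if t: "0 \<le> t" "t \<le> 1" for t
    proof -
      have "y + t *\<^sub>R h \<in> pos_orthant"
        using local_ball_subset_pos_orthant[OF y] tr[OF t] h by simp
      then have "(g has_derivative (\<lambda>k. k \<bullet> G (y + t *\<^sub>R h))) (at (y + t *\<^sub>R h))"
        using grad by (simp add: gderiv_def)
      moreover have "((\<lambda>t. y + t *\<^sub>R h) has_derivative (\<lambda>s. s *\<^sub>R h)) (at t)"
        by (auto intro!: derivative_eq_intros)
      ultimately have "((\<lambda>t. g (y + t *\<^sub>R h)) has_derivative (\<lambda>s. s *\<^sub>R h \<bullet> G (y + t *\<^sub>R h))) (at t)"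
        by (rule has_derivative_compose[rotated])
      then have g': "((\<lambda>t. g (y + t *\<^sub>R h)) has_real_derivative h \<bullet> G (y + t *\<^sub>R h)) (at t)"
        by (simp add: has_field_derivative_def mult_commute_abs)
      have "(\<phi> has_real_derivative
          h \<bullet> G (y + t *\<^sub>R h) - G y \<bullet> h - t * (h \<bullet> (H y *v h))) (at t)"
        unfolding \<phi>_def by (auto intro!: derivative_eq_intros g')
      then show ?thesis
        by (simp add: inner_diff_right inner_commute matrix_vector_mult_scaleR)
    qed
    then obtain t where t: "0 < t" "t < 1" and mvt: "\<phi> 1 - \<phi> 0 = (1 - 0) * (?e t \<bullet> h)"
      using MVT2[OF zero_less_one, of \<phi> "\<lambda>t. ?e t \<bullet> h"] by blast
    have "g (y + h) - g y - G y \<bullet> h - (1 / 2) * (h \<bullet> (H y *v h)) = \<phi> 1 - \<phi> 0"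
      by (simp add: \<phi>_def)
    then have "\<bar>g (y + h) - g y - G y \<bullet> h - (1 / 2) * (h \<bullet> (H y *v h))\<bar> = \<bar>?e t \<bullet> h\<bar>"
      using mvt by simp
    also have "\<dots> \<le> norm (\<chi> i. y $ i * ?e t $ i) * ?r"
      by (rule abs_inner_le_local_norm[OF y])
    also have "\<dots> \<le> (\<bar>T\<bar> * ?r ^ 2 / (2 * (1 - ?r))) * ?r"
    proof (rule mult_right_mono[OF _ r0])
      let ?s = "local_norm y (t *\<^sub>R h)"
      have s: "?s \<le> ?r" using tr t by simp
      have "norm (\<chi> i. y $ i * ?e t $ i) \<le> T * ?s ^ 2 / (2 * (1 - ?s))"
        using bound[OF y] s h by simp
      also have "\<dots> \<le> \<bar>T\<bar> * ?r ^ 2 / (2 * (1 - ?r))"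
        using s h local_norm_nonneg[of y "t *\<^sub>R h"]
        by (intro frac_le mult_mono power_mono) auto
      finally show "norm (\<chi> i. y $ i * ?e t $ i) \<le> \<bar>T\<bar> * ?r ^ 2 / (2 * (1 - ?r))" .
    qed
    also have "\<dots> = (3 * \<bar>T\<bar>) * ?r ^ 3 / (6 * (1 - ?r))"
      using h by (simp add: field_simps power2_eq_square power3_eq_cube)
    finally show ?thesis .
  qed
  with grad der show ?thesis
    unfolding SLC_function_def
    by (intro exI[of _ G] exI[of _ H] conjI exI[of _ "3 * \<bar>T\<bar>"]) simp_all
qed

section \<open>The gradient of the utility\<close>

definition marginal_utility :: "real ^ 'n \<Rightarrow> real \<Rightarrow> real ^ 'n \<Rightarrow> real ^ 'n" where
  "marginal_utility c \<sigma> x = (\<chi> i. c $ i / (c \<bullet> x) + \<sigma> / x $ i)"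

lemma inner_nonneg_pos_orthant:
  assumes "c \<in> nonneg_orthant" "c \<noteq> 0" "x \<in> pos_orthant"
  shows "0 < c \<bullet> x"
proof -
  obtain k where "c $ k \<noteq> 0" using assms(2) by (auto simp: vec_eq_iff)
  then have "0 < c $ k * x $ k" using assms unfolding nonneg_orthant_def pos_orthant_def
    by (metis (mono_tags, lifting) less_eq_real_def mem_Collect_eq mult_pos_pos)
  moreover have "0 \<le> c $ i * x $ i" for i
    using assms by (auto simp: nonneg_orthant_def pos_orthant_def less_imp_le)
  ultimately show ?thesis unfolding inner_vec_def by (auto intro!: sum_pos2[of _ k])
qed

lemma neg_log_utility_alt: "neg_log_utility c \<sigma> x = - (ln (c \<bullet> x) + \<sigma> * (\<Sum>i\<in>UNIV. ln (x $ i)))"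
  by (simp add: neg_log_utility_def inner_vec_def)

lemma GDERIV_neg_log_utility:
  assumes "c \<in> nonneg_orthant" "c \<noteq> 0" "x \<in> pos_orthant"
  shows "GDERIV (neg_log_utility c \<sigma>) x :> - marginal_utility c \<sigma> x"
proof -
  have s: "0 < c \<bullet> x" using inner_nonneg_pos_orthant assms .
  have x: "0 < x $ i" for i using assms by (simp add: pos_orthant_def)
  have nth: "((\<lambda>x :: real ^ 'a. x $ i) has_derivative (\<lambda>h. h $ i)) (at x)" for i
    by (rule bounded_linear_imp_has_derivative[OF bounded_linear_vec_nth])
  have "((\<lambda>x. - (ln (c \<bullet> x) + \<sigma> * (\<Sum>i\<in>UNIV. ln (x $ i)))) has_derivative
      (\<lambda>h. - ((c \<bullet> h) / (c \<bullet> x) + \<sigma> * (\<Sum>i\<in>UNIV. h $ i / x $ i)))) (at x)"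
    using s x
    by (auto intro!: derivative_eq_intros nth simp: divide_inverse mult_ac)
  moreover have "- ((c \<bullet> h) / (c \<bullet> x) + \<sigma> * (\<Sum>i\<in>UNIV. h $ i / x $ i))
      = h \<bullet> - marginal_utility c \<sigma> x" for h
    by (simp add: inner_vec_def[of h] inner_vec_def[of c h] marginal_utility_def sum_distrib_left
        sum_divide_distrib sum.distrib[symmetric] sum_negf[symmetric] algebra_simps)
  ultimately show ?thesis
    by (simp add: gderiv_def neg_log_utility_alt[abs_def])
qed

definition utility_share :: "real ^ 'n \<Rightarrow> real ^ 'n \<Rightarrow> real ^ 'n" where
  "utility_share c x = (\<chi> i. c $ i * x $ i / (c \<bullet> x))"

text \<open>
  The entries of \<open>utility_share c x\<close> are the relative contributions of the goods to
  \<open>\<langle>c, x\<rangle>\<close>. The estimates depend on \<open>c\<close> and \<open>x\<close> only through these entries and hold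
  on the whole simplex, which makes their constants uniform.
\<close>
lemma utility_share_simplex:
  assumes "c \<in> nonneg_orthant" "c \<noteq> 0" "x \<in> pos_orthant"
  shows utility_share_nonneg: "0 \<le> utility_share c x $ i"
    and sum_utility_share: "(\<Sum>i\<in>UNIV. utility_share c x $ i) = 1"
    and utility_share_le_1: "utility_share c x $ i \<le> 1"
proof -
  have s: "0 < c \<bullet> x" using inner_nonneg_pos_orthant assms .
  show nn: "0 \<le> utility_share c x $ i" for i
    using assms s by (auto simp: utility_share_def nonneg_orthant_def pos_orthant_def less_imp_le)
  show one: "(\<Sum>i\<in>UNIV. utility_share c x $ i) = 1"
    using s by (simp add: utility_share_def sum_divide_distrib[symmetric] inner_vec_def)
  show "utility_share c x $ i \<le> 1"
    unfolding one[symmetric] using nn by (intro member_le_sum) auto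
qed

lemma marginal_utility_times:
  assumes "x \<in> pos_orthant"
  shows "x $ i * marginal_utility c \<sigma> x $ i = \<sigma> + utility_share c x $ i"
  using assms by (simp add: marginal_utility_def utility_share_def pos_orthant_def field_simps
      less_imp_neq[symmetric])

text \<open>The Hessian of the negative utility at \<open>x\<close> in the scaled coordinates \<open>\<xi> = diag(x)\<^sup>-\<^sup>1 h\<close>, where
  \<open>a\<close> is the vector of utility shares: the matrix \<open>\<sigma> I + a a\<^sup>T\<close>.\<close>
definition curvature :: "real \<Rightarrow> real ^ 'n \<Rightarrow> real ^ 'n \<Rightarrow> real ^ 'n" where
  "curvature \<sigma> a \<xi> = \<sigma> *\<^sub>R \<xi> + (a \<bullet> \<xi>) *\<^sub>R a"

text \<open>The inverse of \<open>\<sigma> I + a a\<^sup>T\<close> according to the Sherman-Morrison formula.\<close>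
definition curvature_inv :: "real \<Rightarrow> real ^ 'n \<Rightarrow> real ^ 'n \<Rightarrow> real ^ 'n" where
  "curvature_inv \<sigma> a y = (1 / \<sigma>) *\<^sub>R (y - ((a \<bullet> y) / (\<sigma> + a \<bullet> a)) *\<^sub>R a)"

text \<open>The quadratic parts in \<open>1 / (1 + u) = 1 - u + u\<^sup>2 / (1 + u)\<close>, for \<open>u = \<xi>\<^sub>i\<close> (from \<open>\<sigma> / x\<^sub>i\<close>)
  and for \<open>u = \<langle>a, \<xi>\<rangle>\<close> (from \<open>c\<^sub>i / \<langle>c, x\<rangle>\<close>).\<close>
definition remainder :: "real \<Rightarrow> real ^ 'n \<Rightarrow> real ^ 'n \<Rightarrow> real ^ 'n" where
  "remainder \<sigma> a \<xi> = (\<chi> i. \<sigma> * (\<xi> $ i) ^ 2 / (1 + \<xi> $ i) + a $ i * (a \<bullet> \<xi>) ^ 2 / (1 + a \<bullet> \<xi>))"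

lemma linear_curvature: "linear (curvature \<sigma> a)"
  by (rule linearI) (simp_all add: curvature_def algebra_simps inner_add_right)

lemma linear_curvature_inv: "linear (curvature_inv \<sigma> a)"
  by (rule linearI)
    (simp_all add: curvature_inv_def algebra_simps inner_add_right add_divide_distrib)

lemma curvature_inv_curvature:
  assumes "\<sigma> > 0"
  shows "curvature_inv \<sigma> a (curvature \<sigma> a \<xi>) = \<xi>"
proof -
  have "\<sigma> + a \<bullet> a > 0" using assms by (simp add: add_pos_nonneg)
  then have "(a \<bullet> curvature \<sigma> a \<xi>) / (\<sigma> + a \<bullet> a) = a \<bullet> \<xi>"
    by (simp add: curvature_def inner_add_right divide_eq_eq algebra_simps)
  then have "curvature_inv \<sigma> a (curvature \<sigma> a \<xi>)
      = (1 / \<sigma>) *\<^sub>R (curvature \<sigma> a \<xi> - (a \<bullet> \<xi>) *\<^sub>R a)"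
    unfolding curvature_inv_def by simp
  then show ?thesis using assms by (simp add: curvature_def)
qed

lemma curvature_curvature_inv:
  assumes "\<sigma> > 0"
  shows "curvature \<sigma> a (curvature_inv \<sigma> a y) = y"
proof -
  have pos: "\<sigma> + a \<bullet> a > 0" using assms by (simp add: add_pos_nonneg)
  have "a \<bullet> y - (a \<bullet> y) / (\<sigma> + a \<bullet> a) * (a \<bullet> a) = \<sigma> * ((a \<bullet> y) / (\<sigma> + a \<bullet> a))"
    using pos by (simp add: field_simps)
  then have "a \<bullet> curvature_inv \<sigma> a y = (a \<bullet> y) / (\<sigma> + a \<bullet> a)"
    using assms by (simp add: curvature_inv_def inner_diff_right)
  then have "curvature \<sigma> a (curvature_inv \<sigma> a y)
      = \<sigma> *\<^sub>R curvature_inv \<sigma> a y + ((a \<bullet> y) / (\<sigma> + a \<bullet> a)) *\<^sub>R a"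
    unfolding curvature_def by simp
  then show ?thesis using assms by (simp add: curvature_inv_def)
qed

text \<open>\<open>\<sigma> I + a a\<^sup>T\<close> dominates \<open>\<sigma> I\<close>.\<close>
lemma norm_curvature_inv_le:
  assumes "\<sigma> > 0"
  shows "norm (curvature_inv \<sigma> a y) \<le> norm y / \<sigma>"
proof -
  define z where "z = curvature_inv \<sigma> a y"
  have "\<sigma> * norm z ^ 2 \<le> \<sigma> * (z \<bullet> z) + (a \<bullet> z) ^ 2"
    by (simp add: power2_norm_eq_inner)
  also have "\<dots> = z \<bullet> curvature \<sigma> a z"
    by (simp add: curvature_def inner_add_right power2_eq_square inner_commute)
  also have "\<dots> = z \<bullet> y"
    by (simp add: z_def curvature_curvature_inv[OF assms])
  also have "\<dots> \<le> norm z * norm y" by (rule norm_cauchy_schwarz)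
  finally have "norm z * (\<sigma> * norm z) \<le> norm z * norm y"
    by (simp add: power2_eq_square mult_ac)
  then have "\<sigma> * norm z \<le> norm y"
    by (cases "norm z = 0") (auto simp: mult_le_cancel_left)
  then show ?thesis using assms unfolding z_def by (simp add: field_simps)
qed

text \<open>
  The expansion is exact and holds for every step inside the orthant, however large \<open>\<xi>\<close> is.
  It rests on \<open>x\<^sub>i / (x\<^sub>i + h\<^sub>i) = 1 / (1 + \<xi>\<^sub>i)\<close> and
  \<open>\<langle>c, x\<rangle> / \<langle>c, x + h\<rangle> = 1 / (1 + \<langle>a, \<xi>\<rangle>)\<close>.
\<close>
lemma marginal_utility_diff:
  assumes "c \<in> nonneg_orthant" "c \<noteq> 0" "x \<in> pos_orthant" "x + h \<in> pos_orthant"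
  defines "a \<equiv> utility_share c x" and "\<xi> \<equiv> \<chi> i. h $ i / x $ i"
  shows "(\<chi> i. x $ i * (marginal_utility c \<sigma> (x + h) - marginal_utility c \<sigma> x) $ i)
      = remainder \<sigma> a \<xi> - curvature \<sigma> a \<xi>"
    and "\<And>i. 0 < 1 + \<xi> $ i" and "0 < 1 + a \<bullet> \<xi>"
proof -
  let ?s = "c \<bullet> x"
  have s: "0 < ?s" "0 < c \<bullet> (x + h)" using inner_nonneg_pos_orthant assms by blast+
  have x: "0 < x $ i" "0 < x $ i + h $ i" for i using assms(3,4) by (auto simp: pos_orthant_def)
  have "a $ i * \<xi> $ i = c $ i * h $ i / ?s" for i
    using x(1)[of i] by (simp add: a_def \<xi>_def utility_share_def)
  then have "a \<bullet> \<xi> = (\<Sum>i\<in>UNIV. c $ i * h $ i / ?s)"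
    by (simp add: inner_vec_def[of a])
  then have \<tau>: "a \<bullet> \<xi> = (c \<bullet> h) / ?s" by (simp add: inner_vec_def sum_divide_distrib)
  show pos\<xi>: "0 < 1 + \<xi> $ i" for i using x[of i] by (simp add: \<xi>_def field_simps)
  show pos\<tau>: "0 < 1 + a \<bullet> \<xi>" using s by (simp add: \<tau> field_simps inner_add_right)
  have inv: "1 / (1 + u) - 1 = u ^ 2 / (1 + u) - u" if "0 < 1 + u" for u :: real
    using that by (simp add: field_simps power2_eq_square)
  have "x $ i * (marginal_utility c \<sigma> (x + h) - marginal_utility c \<sigma> x) $ i
      = (remainder \<sigma> a \<xi> - curvature \<sigma> a \<xi>) $ i" for i
  proof -
    have "x $ i * (marginal_utility c \<sigma> (x + h) - marginal_utility c \<sigma> x) $ i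
        = \<sigma> * (x $ i / (x $ i + h $ i) - 1) + a $ i * (?s / (c \<bullet> (x + h)) - 1)"
    proof -
      have "a $ i * (?s / (c \<bullet> (x + h))) = x $ i * (c $ i / (c \<bullet> (x + h)))"
        and "a $ i = x $ i * (c $ i / ?s)" and "x $ i * (\<sigma> / x $ i) = \<sigma>"
        using x(1)[of i] s by (simp_all add: a_def utility_share_def)
      then show ?thesis
        using s by (simp add: marginal_utility_def right_diff_distrib distrib_left)
    qed
    also have "x $ i / (x $ i + h $ i) = 1 / (1 + \<xi> $ i)"
      using x[of i] by (simp add: \<xi>_def field_simps)
    also have "?s / (c \<bullet> (x + h)) = 1 / (1 + a \<bullet> \<xi>)"
      using s by (simp add: \<tau> field_simps inner_add_right)
    finally show ?thesis
      unfolding inv[OF pos\<xi>] inv[OF pos\<tau>]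
      by (simp add: remainder_def curvature_def algebra_simps)
  qed
  then show "(\<chi> i. x $ i * (marginal_utility c \<sigma> (x + h) - marginal_utility c \<sigma> x) $ i)
      = remainder \<sigma> a \<xi> - curvature \<sigma> a \<xi>" by (simp add: vec_eq_iff)
qed

text \<open>
  The identity uses \<open>u (u - u\<^sup>2 / (1 + u)) = u\<^sup>2 / (1 + u)\<close>. Because \<open>a\<close> sums to 1, the energy
  \<open>E\<close> is the sum of the nonnegative entries of the remainder, so it dominates its norm.
\<close>
lemma remainder_energy:
  fixes a \<xi> :: "real ^ 'n"
  assumes "\<sigma> > 0" "\<And>i. 0 \<le> a $ i" "(\<Sum>i\<in>UNIV. a $ i) = 1"
    and pos: "\<And>i. 0 < 1 + \<xi> $ i" "0 < 1 + a \<bullet> \<xi>"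
  defines "E \<equiv> \<xi> \<bullet> (curvature \<sigma> a \<xi> - remainder \<sigma> a \<xi>)"
  shows "E = (\<Sum>i\<in>UNIV. \<sigma> * (\<xi> $ i) ^ 2 / (1 + \<xi> $ i)) + (a \<bullet> \<xi>) ^ 2 / (1 + a \<bullet> \<xi>)"
    and "norm (remainder \<sigma> a \<xi>) \<le> E"
proof -
  define \<tau> where "\<tau> = a \<bullet> \<xi>"
  have comp: "u * (u - u ^ 2 / (1 + u)) = u ^ 2 / (1 + u)" if "0 < 1 + u" for u :: real
    using that by (simp add: field_simps power2_eq_square)
  have "E = (\<Sum>i\<in>UNIV. \<sigma> * (\<xi> $ i * (\<xi> $ i - (\<xi> $ i) ^ 2 / (1 + \<xi> $ i)))
      + a $ i * \<xi> $ i * (\<tau> - \<tau> ^ 2 / (1 + \<tau>)))"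
    unfolding E_def inner_vec_def[of \<xi>]
    by (intro sum.cong) (auto simp: curvature_def remainder_def \<tau>_def[symmetric] algebra_simps)
  also have "\<dots> = (\<Sum>i\<in>UNIV. \<sigma> * (\<xi> $ i) ^ 2 / (1 + \<xi> $ i)) + \<tau> * (\<tau> - \<tau> ^ 2 / (1 + \<tau>))"
    using pos(1)
    by (simp add: sum.distrib comp sum_distrib_right[symmetric] \<tau>_def inner_vec_def)
  finally show E: "E = (\<Sum>i\<in>UNIV. \<sigma> * (\<xi> $ i) ^ 2 / (1 + \<xi> $ i)) + (a \<bullet> \<xi>) ^ 2 / (1 + a \<bullet> \<xi>)"
    using pos(2) by (simp add: comp \<tau>_def)
  have "norm (remainder \<sigma> a \<xi>) \<le> (\<Sum>i\<in>UNIV. \<bar>remainder \<sigma> a \<xi> $ i\<bar>)"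
    by (rule norm_le_l1_cart)
  also have "\<dots> = (\<Sum>i\<in>UNIV. remainder \<sigma> a \<xi> $ i)"
    using assms(1,2) pos by (intro sum.cong) (auto simp: remainder_def less_imp_le)
  also have "\<dots> = (\<Sum>i\<in>UNIV. \<sigma> * (\<xi> $ i) ^ 2 / (1 + \<xi> $ i))
      + (\<Sum>i\<in>UNIV. a $ i) * ((a \<bullet> \<xi>) ^ 2 / (1 + a \<bullet> \<xi>))"
    unfolding sum_distrib_right by (simp add: remainder_def sum.distrib)
  finally show "norm (remainder \<sigma> a \<xi>) \<le> E" using E assms(3) by simp
qed

text \<open>
  The error is the remainder. When \<open>\<parallel>\<xi>\<parallel> = \<rho> < 1\<close>, all denominators \<open>1 + \<xi>\<^sub>i\<close> and
  \<open>1 + \<langle>a, \<xi>\<rangle>\<close> are at least \<open>1 - \<rho>\<close>, the latter because \<open>\<langle>a, \<xi>\<rangle>\<close> is an average of the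
  \<open>\<xi>\<^sub>i\<close>.
\<close>
lemma SLC_mapping_marginal_utility:
  assumes "c \<in> nonneg_orthant" "c \<noteq> 0" "\<sigma> > 0"
  shows "SLC_mapping (marginal_utility c \<sigma>)"
proof (rule SLC_mappingI[where K = "\<sigma> + 1" and
      L = "\<lambda>x h. \<chi> i. - curvature \<sigma> (utility_share c x) (\<chi> j. h $ j / x $ j) $ i / x $ i"])
  fix x :: "real ^ 'a" assume x: "x \<in> pos_orthant"
  let ?a = "utility_share c x"
  let ?L = "\<lambda>h. \<chi> i. - curvature \<sigma> ?a (\<chi> j. h $ j / x $ j) $ i / x $ i"
  show "linear ?L"
  proof (rule linearI)
    fix g h :: "real ^ 'a" and r
    have add: "(\<chi> j. (g + h) $ j / x $ j) = (\<chi> j. g $ j / x $ j) + (\<chi> j. h $ j / x $ j)"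
      by (simp add: vec_eq_iff add_divide_distrib)
    show "?L (g + h) = ?L g + ?L h"
      unfolding add linear_add[OF linear_curvature] by (simp add: vec_eq_iff diff_divide_distrib)
    have scale: "(\<chi> j. (r *\<^sub>R g) $ j / x $ j) = r *\<^sub>R (\<chi> j. g $ j / x $ j)"
      by (simp add: vec_eq_iff)
    show "?L (r *\<^sub>R g) = r *\<^sub>R ?L g"
      unfolding scale linear_cmul[OF linear_curvature] by (simp add: vec_eq_iff)
  qed
  fix h assume h: "local_norm x h < 1"
  define \<xi> where "\<xi> = (\<chi> i. h $ i / x $ i)"
  let ?r = "local_norm x h"
  note xh = local_ball_subset_pos_orthant[OF x h]
  note D = marginal_utility_diff[OF assms(1,2) x xh, folded \<xi>_def]
  note S = utility_share_simplex[OF assms(1,2) x]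
  note E = remainder_energy[OF assms(3) S(1,2) D(2,3)]
  have r: "norm \<xi> = ?r" by (simp add: \<xi>_def local_norm_def)
  have xi: "\<bar>\<xi> $ i\<bar> \<le> ?r" for i using component_le_norm_cart[of \<xi> i] r by simp
  have "\<bar>?a \<bullet> \<xi>\<bar> \<le> (\<Sum>i\<in>UNIV. \<bar>?a $ i * \<xi> $ i\<bar>)"
    unfolding inner_vec_def by (simp add: sum_abs)
  also have "\<dots> \<le> (\<Sum>i\<in>UNIV. ?a $ i * ?r)"
    using xi S(1) by (intro sum_mono) (simp add: abs_mult mult_left_mono)
  also have "\<dots> = ?r" using S(2) by (simp add: sum_distrib_right[symmetric])
  finally have \<tau>: "\<bar>?a \<bullet> \<xi>\<bar> \<le> ?r" .
  have "(\<chi> i. x $ i * (marginal_utility c \<sigma> (x + h) - marginal_utility c \<sigma> x - ?L h) $ i)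
      = (\<chi> i. x $ i * (marginal_utility c \<sigma> (x + h) - marginal_utility c \<sigma> x) $ i)
        + curvature \<sigma> ?a \<xi>"
    using x by (simp add: vec_eq_iff \<xi>_def algebra_simps pos_orthant_def less_imp_neq[symmetric])
  then have "(\<chi> i. x $ i * (marginal_utility c \<sigma> (x + h) - marginal_utility c \<sigma> x - ?L h) $ i)
      = remainder \<sigma> ?a \<xi>" using D(1) by simp
  also have "norm (remainder \<sigma> ?a \<xi>)
      \<le> (\<Sum>i\<in>UNIV. \<sigma> * (\<xi> $ i) ^ 2 / (1 + \<xi> $ i)) + (?a \<bullet> \<xi>) ^ 2 / (1 + ?a \<bullet> \<xi>)"
    using E by simp
  also have "\<dots> \<le> (\<Sum>i\<in>UNIV. \<sigma> * (\<xi> $ i) ^ 2 / (1 - ?r)) + ?r ^ 2 / (1 - ?r)"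
  proof (intro add_mono sum_mono)
    fix i
    show "\<sigma> * (\<xi> $ i) ^ 2 / (1 + \<xi> $ i) \<le> \<sigma> * (\<xi> $ i) ^ 2 / (1 - ?r)"
      using xi[of i] h assms(3) by (intro frac_le) auto
    have "(?a \<bullet> \<xi>) ^ 2 \<le> ?r ^ 2" using \<tau> by (simp add: abs_le_square_iff[symmetric])
    then show "(?a \<bullet> \<xi>) ^ 2 / (1 + ?a \<bullet> \<xi>) \<le> ?r ^ 2 / (1 - ?r)"
      using \<tau> h by (intro frac_le) auto
  qed
  also have "(\<Sum>i\<in>UNIV. \<sigma> * (\<xi> $ i) ^ 2 / (1 - ?r)) = \<sigma> * ?r ^ 2 / (1 - ?r)"
    unfolding r[symmetric] power2_norm_eq_inner inner_vec_def
    by (simp add: sum_divide_distrib sum_distrib_left power2_eq_square)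
  also have "\<sigma> * ?r ^ 2 / (1 - ?r) + ?r ^ 2 / (1 - ?r) = (\<sigma> + 1) * ?r ^ 2 / (1 - ?r)"
    by (simp add: add_divide_distrib algebra_simps)
  finally show "norm (\<chi> i. x $ i * (marginal_utility c \<sigma> (x + h) - marginal_utility c \<sigma> x - ?L h) $ i)
      \<le> (\<sigma> + 1) * ?r ^ 2 / (1 - ?r)" .
qed

section \<open>The best response inverts the marginal utility\<close>

text \<open>
  Writing \<open>u\<close> for \<open>1 / (\<mu> \<langle>c, x\<rangle>)\<close>, the equation reads \<open>x\<^sub>i = \<sigma> / (\<mu> (p\<^sub>i - u c\<^sub>i))\<close>, and it
  remains to make \<open>u\<close> consistent with this \<open>x\<close>: a scalar equation \<open>F(u) = 1\<close>, solved by the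
  intermediate value theorem.
\<close>
lemma ex_marginal_utility_eq:
  fixes c p :: "real ^ 'n"
  assumes c: "c \<in> nonneg_orthant" "c \<noteq> 0" and "\<sigma> > 0" "\<mu> > 0" and p: "p \<in> pos_orthant"
  shows "\<exists>x \<in> pos_orthant. marginal_utility c \<sigma> x = \<mu> *\<^sub>R p"
proof -
  have p0: "0 < p $ i" for i using p by (simp add: pos_orthant_def)
  have c0: "0 \<le> c $ i" for i using c by (simp add: nonneg_orthant_def)
  define m where "m = Max (range (\<lambda>i. c $ i / p $ i))"
  have m: "c $ i / p $ i \<le> m" for i by (auto simp: m_def)
  have "m \<in> range (\<lambda>i. c $ i / p $ i)" unfolding m_def by (intro Max_in) auto
  then obtain k where k: "m = c $ k / p $ k" by auto
  obtain j where "c $ j \<noteq> 0" using c(2) by (auto simp: vec_eq_iff)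
  then have "0 < c $ j / p $ j" using c0[of j] p0[of j] by simp
  then have m0: "m > 0" using m[of j] by linarith
  \<comment> \<open>At \<open>U\<close> the summand of \<open>F\<close> with the largest ratio \<open>c\<^sub>k / p\<^sub>k = m\<close> equals 1 on its own,
    while all denominators are still positive.\<close>
  define U where "U = 1 / ((1 + \<sigma>) * m)"
  have U0: "U > 0" using m0 \<open>\<sigma> > 0\<close> by (simp add: U_def)
  have slack: "0 < p $ i - u * c $ i" if "u \<le> U" for u i
  proof -
    have "u * c $ i \<le> U * (m * p $ i)"
      using that U0 c0[of i] m[of i] p0[of i] by (intro mult_mono) (auto simp: field_simps)
    also have "\<dots> = p $ i / (1 + \<sigma>)" using m0 by (simp add: U_def)
    also have "\<dots> < p $ i" using p0[of i] \<open>\<sigma> > 0\<close> by (simp add: field_simps)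
    finally show ?thesis by simp
  qed
  define F where "F u = (\<Sum>i\<in>UNIV. \<sigma> * u * c $ i / (p $ i - u * c $ i))" for u
  have "continuous_on {0..U} F"
    unfolding F_def using slack
    by (intro continuous_intros) (auto simp: less_imp_neq[symmetric])
  moreover have "F 0 \<le> 1" by (simp add: F_def)
  moreover have "1 \<le> F U"
  proof -
    have ck: "c $ k = m * p $ k" using k p0[of k] by simp
    have Um: "U * m = 1 / (1 + \<sigma>)" using m0 by (simp add: U_def)
    have uc: "U * c $ k = p $ k / (1 + \<sigma>)" unfolding ck using Um by (metis mult.assoc mult.commute mult.right_neutral times_divide_eq_right)
    have "1 = \<sigma> * (U * c $ k) / (p $ k - U * c $ k)"
      unfolding uc using p0[of k] \<open>\<sigma> > 0\<close> by (simp add: field_simps)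
    also have "\<dots> = \<sigma> * U * c $ k / (p $ k - U * c $ k)" by simp
    also have "\<dots> \<le> F U"
      unfolding F_def
      by (rule member_le_sum[of k UNIV "\<lambda>i. \<sigma> * U * c $ i / (p $ i - U * c $ i)"])
        (use slack[of U] U0 c0 \<open>\<sigma> > 0\<close> in \<open>auto simp: less_imp_le\<close>)
    finally show ?thesis .
  qed
  ultimately obtain u where u: "0 \<le> u" "u \<le> U" "F u = 1"
    using IVT'[of F 0 1 U] U0 by auto
  have u0: "u > 0" using u by (cases "u = 0") (auto simp: F_def)
  define x where "x = (\<chi> i. \<sigma> / (\<mu> * (p $ i - u * c $ i)))"
  have x: "x \<in> pos_orthant"
    using slack[OF u(2)] assms(3,4) by (simp add: x_def pos_orthant_def)
  have "\<mu> * u * (c \<bullet> x) = F u"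
    unfolding inner_vec_def F_def sum_distrib_left
    using slack[OF u(2)] \<open>\<mu> > 0\<close>
    by (intro sum.cong) (auto simp: x_def less_imp_neq[symmetric])
  then have "c \<bullet> x = 1 / (\<mu> * u)" using u u0 \<open>\<mu> > 0\<close> by (simp add: field_simps)
  then have "marginal_utility c \<sigma> x $ i = c $ i * (\<mu> * u) + \<mu> * (p $ i - u * c $ i)" for i
    using assms(3) by (simp add: marginal_utility_def x_def)
  then have "marginal_utility c \<sigma> x = \<mu> *\<^sub>R p"
    by (simp add: vec_eq_iff algebra_simps)
  with x show ?thesis by blast
qed

lemma ln_less_minus_one:
  assumes "0 < (t :: real)" "t \<noteq> 1"
  shows "ln t < t - 1"
  using ln_le_minus_one[of t] ln_eq_minus_one[of t] assms by fastforce

lemma inner_marginal_utility: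
  fixes c x :: "real ^ 'n"
  assumes "c \<in> nonneg_orthant" "c \<noteq> 0" "x \<in> pos_orthant"
  shows "x \<bullet> marginal_utility c \<sigma> x = 1 + real CARD('n) * \<sigma>"
  using sum_utility_share[OF assms]
  by (simp add: inner_vec_def marginal_utility_times[OF assms(3)] sum.distrib)

text \<open>The strict gradient inequality for the strictly convex \<open>v\<close>, from \<open>ln t \<le> t - 1\<close> with equality
  only at 1, applied to the ratios \<open>y\<^sub>i / x\<^sub>i\<close> and \<open>\<langle>c, y\<rangle> / \<langle>c, x\<rangle>\<close>.\<close>
lemma neg_log_utility_tangent:
  fixes c x y :: "real ^ 'n"
  assumes c: "c \<in> nonneg_orthant" "c \<noteq> 0" and "\<sigma> > 0"
    and x: "x \<in> pos_orthant" and y: "y \<in> pos_orthant" and "y \<noteq> x"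
  shows "neg_log_utility c \<sigma> x - neg_log_utility c \<sigma> y < (y - x) \<bullet> marginal_utility c \<sigma> x"
proof -
  have s: "0 < c \<bullet> x" "0 < c \<bullet> y" using inner_nonneg_pos_orthant c x y by auto
  have x0: "0 < x $ i" and y0: "0 < y $ i" for i using x y by (auto simp: pos_orthant_def)
  have 1: "ln (c \<bullet> y) - ln (c \<bullet> x) \<le> (c \<bullet> y) / (c \<bullet> x) - 1"
    using ln_le_minus_one[of "(c \<bullet> y) / (c \<bullet> x)"] s by (simp add: ln_div)
  have 2: "(\<Sum>i\<in>UNIV. ln (y $ i) - ln (x $ i)) < (\<Sum>i\<in>UNIV. y $ i / x $ i - 1)"
  proof (rule sum_strict_mono_ex1)
    show "\<forall>i\<in>UNIV. ln (y $ i) - ln (x $ i) \<le> y $ i / x $ i - 1"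
    proof
      fix i
      show "ln (y $ i) - ln (x $ i) \<le> y $ i / x $ i - 1"
        using ln_le_minus_one[of "y $ i / x $ i"] x0[of i] y0[of i] by (simp add: ln_div)
    qed
    obtain k where "y $ k \<noteq> x $ k" using \<open>y \<noteq> x\<close> by (auto simp: vec_eq_iff)
    then have "ln (y $ k / x $ k) < y $ k / x $ k - 1"
      using x0[of k] y0[of k] by (intro ln_less_minus_one) auto
    then have "ln (y $ k) - ln (x $ k) < y $ k / x $ k - 1"
      using x0[of k] y0[of k] by (simp add: ln_div)
    then show "\<exists>i\<in>UNIV. ln (y $ i) - ln (x $ i) < y $ i / x $ i - 1" by blast
  qed simp
  have "(y - x) \<bullet> marginal_utility c \<sigma> x
      = (\<Sum>i\<in>UNIV. c $ i * y $ i / (c \<bullet> x) - c $ i * x $ i / (c \<bullet> x)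
          + \<sigma> * (y $ i / x $ i - 1))"
    unfolding inner_vec_def[of "y - x"] using x0
    by (intro sum.cong)
      (auto simp: marginal_utility_def algebra_simps diff_divide_distrib less_imp_neq[symmetric])
  also have "\<dots> = (c \<bullet> y) / (c \<bullet> x) - 1 + \<sigma> * (\<Sum>i\<in>UNIV. y $ i / x $ i - 1)"
    unfolding sum.distrib sum_subtractf sum_distrib_left[symmetric] sum_divide_distrib[symmetric]
    using s by (simp add: inner_vec_def[of c, simplified, symmetric])
  finally have T: "(y - x) \<bullet> marginal_utility c \<sigma> x
      = (c \<bullet> y) / (c \<bullet> x) - 1 + \<sigma> * (\<Sum>i\<in>UNIV. y $ i / x $ i - 1)" .
  have "\<sigma> * (\<Sum>i\<in>UNIV. ln (y $ i) - ln (x $ i)) < \<sigma> * (\<Sum>i\<in>UNIV. y $ i / x $ i - 1)"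
    using 2 \<open>\<sigma> > 0\<close> by simp
  with 1 show ?thesis unfolding T neg_log_utility_alt by (simp add: sum_subtractf algebra_simps)
qed

text \<open>The Lagrange multiplier of the budget constraint. The type argument supplies the dimension.\<close>
definition budget_multiplier :: "'n itself \<Rightarrow> real \<Rightarrow> real \<Rightarrow> real" where
  "budget_multiplier _ \<sigma> w = (1 + real CARD('n) * \<sigma>) / w"

lemma budget_multiplier_pos: "\<sigma> > 0 \<Longrightarrow> w > 0 \<Longrightarrow> 0 < budget_multiplier TYPE('n::finite) \<sigma> w"
  by (simp add: budget_multiplier_def add_pos_nonneg)

text \<open>The value of \<open>\<langle>x, m(x)\<rangle>\<close> makes the budget bind at a stationary point; the tangent inequality
  there then excludes every other point of the budget set.\<close>
lemma stationary_is_maximizer: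
  fixes c p x y :: "real ^ 'n"
  assumes c: "c \<in> nonneg_orthant" "c \<noteq> 0" and "\<sigma> > 0" "w > 0"
    and x: "x \<in> pos_orthant" "marginal_utility c \<sigma> x = budget_multiplier TYPE('n) \<sigma> w *\<^sub>R p"
  shows "p \<bullet> x = w" and "x \<in> budget_set w p"
    and "\<lbrakk>y \<in> budget_set w p; y \<noteq> x\<rbrakk> \<Longrightarrow> utility_objective c \<sigma> y < utility_objective c \<sigma> x"
proof -
  let ?\<mu> = "budget_multiplier TYPE('n) \<sigma> w"
  have \<mu>: "?\<mu> > 0" using budget_multiplier_pos assms(3,4) .
  have "?\<mu> * (p \<bullet> x) = ?\<mu> * w"
    using inner_marginal_utility[OF c x(1), of \<sigma>] \<open>w > 0\<close> unfolding x(2)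
    by (simp add: budget_multiplier_def inner_commute)
  then show px: "p \<bullet> x = w" using \<mu> by simp
  then show "x \<in> budget_set w p"
    using x(1) by (auto simp: budget_set_def nonneg_orthant_def pos_orthant_def less_imp_le)
  assume y: "y \<in> budget_set w p" "y \<noteq> x"
  show "utility_objective c \<sigma> y < utility_objective c \<sigma> x"
  proof (cases "y \<in> pos_orthant")
    case True
    have "neg_log_utility c \<sigma> x - neg_log_utility c \<sigma> y < (y - x) \<bullet> marginal_utility c \<sigma> x"
      using neg_log_utility_tangent[OF c \<open>\<sigma> > 0\<close> x(1) True y(2)] .
    also have "\<dots> = ?\<mu> * (p \<bullet> y - w)"
      unfolding x(2) by (simp add: inner_diff_left inner_commute px algebra_simps)
    also have "\<dots> \<le> 0" using y(1) \<mu> by (simp add: budget_set_def mult_le_0_iff)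
    finally show ?thesis using True x(1) by (simp add: utility_objective_def)
  qed (use x(1) in \<open>simp add: utility_objective_def\<close>)
qed

lemma best_response:
  fixes c p :: "real ^ 'n"
  assumes c: "c \<in> nonneg_orthant" "c \<noteq> 0" and \<sigma>: "\<sigma> > 0" and w: "w > 0" and p: "p \<in> pos_orthant"
  defines "x \<equiv> best_response c \<sigma> w p"
  shows best_response_pos: "x \<in> pos_orthant"
    and marginal_utility_best_response:
      "marginal_utility c \<sigma> x = budget_multiplier TYPE('n) \<sigma> w *\<^sub>R p"
    and inner_best_response: "p \<bullet> x = w"
    and dual_function_eq: "dual_function c \<sigma> w p = - neg_log_utility c \<sigma> x"
    and unique_maximizer:
      "\<exists>!x. is_arg_max (utility_objective c \<sigma>) (\<lambda>x. x \<in> budget_set w p) x"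
proof -
  obtain z where z: "z \<in> pos_orthant"
    "marginal_utility c \<sigma> z = budget_multiplier TYPE('n) \<sigma> w *\<^sub>R p"
    using ex_marginal_utility_eq[OF c \<sigma> budget_multiplier_pos[OF \<sigma> w] p] by blast
  note M = stationary_is_maximizer[OF c \<sigma> w z]
  have max: "is_arg_max (utility_objective c \<sigma>) (\<lambda>x. x \<in> budget_set w p) y \<longleftrightarrow> y = z" for y
    unfolding is_arg_max_def using M(2,3) by (metis order_less_asym)
  then show "\<exists>!x. is_arg_max (utility_objective c \<sigma>) (\<lambda>x. x \<in> budget_set w p) x" by simp
  have xz: "x = z" unfolding x_def best_response_def arg_max_on_def arg_max_def
    by (rule some_equality) (simp_all add: max)
  show "x \<in> pos_orthant" "marginal_utility c \<sigma> x = budget_multiplier TYPE('n) \<sigma> w *\<^sub>R p"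
    "p \<bullet> x = w" using z M(1) xz by auto
  have "(SUP y \<in> budget_set w p. utility_objective c \<sigma> y) = utility_objective c \<sigma> z"
    using M(2,3) by (intro antisym SUP_least SUP_upper) (auto simp: less_imp_le le_less)
  then show "dual_function c \<sigma> w p = - neg_log_utility c \<sigma> x"
    using z(1) by (simp add: dual_function_def utility_objective_def xz)
qed

section \<open>Scaled Lipschitz continuity of the best response\<close>

text \<open>
  The energy identity is used twice. As \<open>\<parallel>R\<parallel> \<le> \<langle>\<xi>, y\<rangle>\<close> it bounds the remainder by
  \<open>\<rho> \<parallel>\<xi>\<parallel>\<close>, only linearly in \<open>\<xi>\<close>; as a lower bound of \<open>\<langle>\<xi>, y\<rangle>\<close> by
  \<open>\<sigma> \<parallel>\<xi>\<parallel>\<^sup>2 / B\<close> with \<open>1 + \<xi>\<^sub>i \<le> B\<close> it bounds \<open>\<parallel>\<xi>\<parallel>\<close> by a multiple of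
  \<open>\<rho> / (1 - \<rho>)\<close>. Estimating \<open>R\<close> quadratically in \<open>\<xi>\<close> would lose a further factor
  \<open>1 / (1 - \<rho>)\<close>, which the definition does not tolerate.
\<close>
lemma SLC_mapping_best_response:
  fixes c :: "real ^ 'n"
  assumes c: "c \<in> nonneg_orthant" "c \<noteq> 0" and \<sigma>: "\<sigma> > 0" and w: "w > 0"
  shows "SLC_mapping (best_response c \<sigma> w)"
proof -
  define \<mu> where "\<mu> = budget_multiplier TYPE('n) \<sigma> w"
  have \<mu>: "\<mu> > 0" unfolding \<mu>_def using budget_multiplier_pos \<sigma> w .
  let ?x = "best_response c \<sigma> w"
  \<comment> \<open>The linear part \<open>A\<^sup>-\<^sup>1 y\<close> of \<open>\<xi>\<close>, scaled back by \<open>diag(x(p))\<close>.\<close>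
  define L where "L p q = (\<chi> i. ?x p $ i *
      curvature_inv \<sigma> (utility_share c (?x p)) (\<chi> j. - (\<mu> * ?x p $ j * q $ j)) $ i)" for p q
  \<comment> \<open>The factors bound \<open>p\<^sub>i x\<^sub>i\<close>, then \<open>\<parallel>R\<parallel>\<close> up to \<open>\<rho>\<^sup>2 / (1 - \<rho>)\<close>, then
    \<open>A\<^sup>-\<^sup>1\<close>.\<close>
  define C where "C = (1 + \<sigma>) / \<mu> * ((1 + \<sigma>) ^ 3 / \<sigma> ^ 2) / \<sigma>"
  show ?thesis
  proof (rule SLC_mappingI[where L = L and K = C])
    fix p :: "real ^ 'n" assume p: "p \<in> pos_orthant"
    define x where "x = ?x p"
    define a where "a = utility_share c x"
    show "linear (L p)"
    proof (rule linearI)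
      fix g h :: "real ^ 'n" and r
      have add: "(\<chi> j. - (\<mu> * ?x p $ j * (g + h) $ j))
          = (\<chi> j. - (\<mu> * ?x p $ j * g $ j)) + (\<chi> j. - (\<mu> * ?x p $ j * h $ j))"
        by (simp add: vec_eq_iff algebra_simps)
      show "L p (g + h) = L p g + L p h"
        unfolding L_def add linear_add[OF linear_curvature_inv]
        by (simp add: vec_eq_iff distrib_left)
      have scale: "(\<chi> j. - (\<mu> * ?x p $ j * (r *\<^sub>R g) $ j)) = r *\<^sub>R (\<chi> j. - (\<mu> * ?x p $ j * g $ j))"
        by (simp add: vec_eq_iff)
      show "L p (r *\<^sub>R g) = r *\<^sub>R L p g"
        unfolding L_def scale linear_cmul[OF linear_curvature_inv] by (simp add: vec_eq_iff)
    qed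
    fix q assume q: "local_norm p q < 1"
    let ?r = "local_norm p q"
    note pq = local_ball_subset_pos_orthant[OF p q]
    define h where "h = ?x (p + q) - x"
    have xh: "?x (p + q) = x + h" by (simp add: h_def)
    define \<xi> where "\<xi> = (\<chi> i. h $ i / x $ i)"
    note X = best_response[OF c \<sigma> w p, folded x_def \<mu>_def]
    note X' = best_response[OF c \<sigma> w pq, folded \<mu>_def, unfolded xh]
    note D = marginal_utility_diff[OF c X(1) X'(1), folded \<xi>_def a_def]
    note S = utility_share_simplex[OF c X(1), folded a_def]
    note E = remainder_energy[OF \<sigma> S(1,2) D(2,3)]
    define y where "y = (\<chi> j. - (\<mu> * x $ j * q $ j))"
    define R where "R = remainder \<sigma> a \<xi>"
    have x0: "0 < x $ i" and p0: "0 < p $ i" for i using X(1) p by (auto simp: pos_orthant_def)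
    have eq: "curvature \<sigma> a \<xi> - R = y"
    proof -
      have "(\<chi> i. x $ i * (marginal_utility c \<sigma> (x + h) - marginal_utility c \<sigma> x) $ i) = - y"
        unfolding X(2) X'(2) by (simp add: y_def vec_eq_iff algebra_simps)
      then show ?thesis unfolding D(1) R_def by (metis minus_diff_eq minus_minus)
    qed
    have share: "\<mu> * (p $ i * x $ i) = \<sigma> + a $ i" for i
      using marginal_utility_times[OF X(1), of i c \<sigma>] unfolding X(2) a_def
      by (simp add: mult_ac)
    have y_le: "norm y \<le> (1 + \<sigma>) * ?r"
    proof -
      have "norm y \<le> norm ((1 + \<sigma>) *\<^sub>R (\<chi> i. q $ i / p $ i))"
      proof (rule norm_le_componentwise_cart)
        fix i
        have "y $ i = - ((\<sigma> + a $ i) * (q $ i / p $ i))"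
          unfolding share[symmetric] y_def using p0[of i] by simp
        moreover have "\<bar>\<sigma> + a $ i\<bar> \<le> \<bar>1 + \<sigma>\<bar>" using S(1,3)[of i] \<sigma> by simp
        ultimately show "norm (y $ i) \<le> norm (((1 + \<sigma>) *\<^sub>R (\<chi> i. q $ i / p $ i)) $ i)"
          by (simp add: abs_mult divide_right_mono mult_right_mono)
      qed
      then show ?thesis using \<sigma> by (simp add: local_norm_def)
    qed
    have energy: "\<xi> \<bullet> y \<le> norm \<xi> * ((1 + \<sigma>) * ?r)"
      using norm_cauchy_schwarz[of \<xi> y] mult_left_mono[OF y_le norm_ge_zero[of \<xi>]] by linarith
    \<comment> \<open>\<open>1 + \<xi>\<^sub>i\<close> is the ratio of the new to the old demand for good \<open>i\<close>. The spending on it,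
      times \<open>\<mu>\<close>, stays between \<open>\<sigma>\<close> and \<open>1 + \<sigma>\<close>, and its price drops at most by the
      factor \<open>1 - \<rho>\<close>.\<close>
    define B where "B = (1 + \<sigma>) / (\<sigma> * (1 - ?r))"
    have B0: "B > 0" using \<sigma> q by (simp add: B_def)
    have xi_le: "1 + \<xi> $ i \<le> B" for i
    proof -
      have "p $ i * (1 - ?r) \<le> p $ i + q $ i"
        using abs_ratio_le_local_norm[of q i p] p0[of i] by (simp add: field_simps abs_le_iff)
      moreover have xh0: "0 < x $ i + h $ i" using X'(1) by (simp add: pos_orthant_def)
      ultimately have "\<mu> * (p $ i * (1 - ?r)) * (x $ i + h $ i)
          \<le> \<mu> * (p $ i + q $ i) * (x $ i + h $ i)"
        using \<mu> by (intro mult_right_mono mult_left_mono) auto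
      also have "\<dots> = \<sigma> + utility_share c (x + h) $ i"
        using marginal_utility_times[OF X'(1), of i c \<sigma>] unfolding X'(2) by (simp add: mult_ac)
      also have "\<dots> \<le> 1 + \<sigma>" using utility_share_le_1[OF c X'(1), of i] by simp
      finally have "\<mu> * (p $ i * (1 - ?r)) * (x $ i + h $ i) \<le> 1 + \<sigma>" .
      moreover have "x $ i + h $ i = x $ i * (1 + \<xi> $ i)"
        using x0[of i] by (simp add: \<xi>_def distrib_left)
      ultimately have "(\<mu> * (p $ i * x $ i)) * ((1 - ?r) * (1 + \<xi> $ i)) \<le> 1 + \<sigma>"
        by (simp only: mult_ac)
      moreover have "\<sigma> * ((1 - ?r) * (1 + \<xi> $ i))
          \<le> (\<mu> * (p $ i * x $ i)) * ((1 - ?r) * (1 + \<xi> $ i))"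
        unfolding share using S(1)[of i] q D(2)[of i] by (intro mult_right_mono) auto
      ultimately have "\<sigma> * ((1 - ?r) * (1 + \<xi> $ i)) \<le> 1 + \<sigma>" by linarith
      then show ?thesis unfolding B_def using \<sigma> q by (simp add: pos_le_divide_eq mult_ac)
    qed
    have "\<sigma> * norm \<xi> ^ 2 / B = (\<Sum>i\<in>UNIV. \<sigma> * (\<xi> $ i) ^ 2 / B)"
      unfolding power2_norm_eq_inner inner_vec_def
      by (simp add: sum_divide_distrib sum_distrib_left power2_eq_square)
    also have "\<dots> \<le> (\<Sum>i\<in>UNIV. \<sigma> * (\<xi> $ i) ^ 2 / (1 + \<xi> $ i))"
      using xi_le D(2) \<sigma> by (intro sum_mono divide_left_mono) (auto intro: mult_pos_pos B0)
    also have "\<dots> \<le> \<xi> \<bullet> y"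
      using E(1) D(3) unfolding R_def[symmetric] eq by simp
    also have "\<dots> \<le> norm \<xi> * ((1 + \<sigma>) * ?r)" by (rule energy)
    finally have "norm \<xi> * (\<sigma> * norm \<xi>) \<le> norm \<xi> * (B * ((1 + \<sigma>) * ?r))"
      using B0 by (simp add: field_simps power2_eq_square)
    then have "\<sigma> * norm \<xi> \<le> B * ((1 + \<sigma>) * ?r)"
      using B0 \<sigma> local_norm_nonneg[of p q]
      by (cases "norm \<xi> = 0") (auto simp: mult_le_cancel_left)
    then have xi_norm: "norm \<xi> \<le> B * ((1 + \<sigma>) * ?r) / \<sigma>" using \<sigma> by (simp add: field_simps)
    have "norm R \<le> norm \<xi> * ((1 + \<sigma>) * ?r)"
      using E(2) energy unfolding R_def[symmetric] eq by simp
    also have "\<dots> \<le> B * ((1 + \<sigma>) * ?r) / \<sigma> * ((1 + \<sigma>) * ?r)"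
      using xi_norm \<sigma> local_norm_nonneg[of p q] by (intro mult_right_mono) auto
    also have "\<dots> = (1 + \<sigma>) ^ 3 / \<sigma> ^ 2 * ?r ^ 2 / (1 - ?r)"
      by (simp add: B_def power2_eq_square power3_eq_cube mult_ac)
    finally have R_le: "norm R \<le> (1 + \<sigma>) ^ 3 / \<sigma> ^ 2 * ?r ^ 2 / (1 - ?r)" .
    have err: "(?x (p + q) - ?x p - L p q) $ i = x $ i * curvature_inv \<sigma> a R $ i" for i
    proof -
      have "\<xi> = curvature_inv \<sigma> a (y + R)"
        using curvature_inv_curvature[OF \<sigma>, of a \<xi>] eq by (metis diff_add_cancel)
      then have "\<xi> $ i = curvature_inv \<sigma> a y $ i + curvature_inv \<sigma> a R $ i"
        by (simp add: linear_add[OF linear_curvature_inv])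
      moreover have "h $ i = x $ i * \<xi> $ i" using x0[of i] by (simp add: \<xi>_def)
      moreover have "L p q $ i = x $ i * curvature_inv \<sigma> a y $ i"
        by (simp add: L_def x_def a_def y_def)
      moreover have "?x (p + q) - ?x p = h" by (simp add: h_def x_def)
      ultimately show ?thesis by (simp add: algebra_simps)
    qed
    have "norm (\<chi> i. p $ i * (?x (p + q) - ?x p - L p q) $ i)
        \<le> norm (((1 + \<sigma>) / \<mu>) *\<^sub>R curvature_inv \<sigma> a R)"
    proof (rule norm_le_componentwise_cart)
      fix i
      have "p $ i * x $ i \<le> (1 + \<sigma>) / \<mu>"
        using share[of i] S(3)[of i] \<mu> by (simp add: field_simps)
      moreover have "0 < p $ i * x $ i" using p0 x0 by simp
      ultimately have "\<bar>p $ i * x $ i\<bar> * \<bar>curvature_inv \<sigma> a R $ i\<bar>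
          \<le> \<bar>(1 + \<sigma>) / \<mu>\<bar> * \<bar>curvature_inv \<sigma> a R $ i\<bar>"
        using \<sigma> \<mu> by (intro mult_right_mono) auto
      then show "norm ((\<chi> i. p $ i * (?x (p + q) - ?x p - L p q) $ i) $ i)
          \<le> norm ((((1 + \<sigma>) / \<mu>) *\<^sub>R curvature_inv \<sigma> a R) $ i)"
        unfolding err vec_lambda_beta vector_scaleR_component real_norm_def
        by (simp only: abs_mult mult.assoc real_scaleR_def)
    qed
    also have "\<dots> = (1 + \<sigma>) / \<mu> * norm (curvature_inv \<sigma> a R)" using \<sigma> \<mu> by simp
    also have "\<dots> \<le> (1 + \<sigma>) / \<mu> * (((1 + \<sigma>) ^ 3 / \<sigma> ^ 2 * ?r ^ 2 / (1 - ?r)) / \<sigma>)"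
      using \<sigma> \<mu> R_le
      by (intro mult_left_mono order_trans[OF norm_curvature_inv_le[OF \<sigma>]] divide_right_mono) auto
    also have "\<dots> = C * ?r ^ 2 / (1 - ?r)" by (simp add: C_def mult_ac)
    finally show "norm (\<chi> i. p $ i * (?x (p + q) - ?x p - L p q) $ i) \<le> C * ?r ^ 2 / (1 - ?r)" .
  qed
qed

text \<open>
  The envelope theorem. By the chain rule the derivative in direction \<open>q\<close> is
  \<open>\<langle>m(x(p)), J q\<rangle> = \<mu> \<langle>p, J q\<rangle>\<close>, and differentiating the binding budget
  \<open>\<langle>p, x(p)\<rangle> = w\<close> gives \<open>\<langle>p, J q\<rangle> = - \<langle>q, x(p)\<rangle>\<close>.
\<close>
lemma GDERIV_dual_function:
  fixes c p :: "real ^ 'n"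
  assumes c: "c \<in> nonneg_orthant" "c \<noteq> 0" and \<sigma>: "\<sigma> > 0" and w: "w > 0" and p: "p \<in> pos_orthant"
  shows "GDERIV (dual_function c \<sigma> w) p
    :> (- budget_multiplier TYPE('n) \<sigma> w) *\<^sub>R best_response c \<sigma> w p"
proof -
  let ?x = "best_response c \<sigma> w" and ?\<mu> = "budget_multiplier TYPE('n) \<sigma> w"
  note X = best_response[OF c \<sigma> w]
  obtain J where J: "(?x has_derivative J) (at p)"
    using SLC_mapping_best_response[OF c \<sigma> w] p unfolding SLC_mapping_def by blast
  have "((\<lambda>p. p \<bullet> ?x p) has_derivative (\<lambda>q. p \<bullet> J q + q \<bullet> ?x p)) (at p)"
    by (intro derivative_intros J)
  moreover have "((\<lambda>p. p \<bullet> ?x p) has_derivative (\<lambda>q. 0)) (at p)"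
    by (rule has_derivative_transform_within_open[OF has_derivative_const[of w] open_pos_orthant p])
      (simp add: X(3))
  ultimately have "(\<lambda>q. p \<bullet> J q + q \<bullet> ?x p) = (\<lambda>q. 0)" by (rule has_derivative_unique)
  then have budget: "p \<bullet> J q = - (q \<bullet> ?x p)" for q by (metis add_eq_0_iff2)
  have "(neg_log_utility c \<sigma> has_derivative (\<lambda>h. h \<bullet> - marginal_utility c \<sigma> (?x p))) (at (?x p))"
    using GDERIV_neg_log_utility[OF c X(1)[OF p]] by (simp add: gderiv_def)
  from has_derivative_minus[OF has_derivative_compose[OF J this]]
  have "((\<lambda>p. - neg_log_utility c \<sigma> (?x p)) has_derivative
      (\<lambda>q. - (J q \<bullet> - marginal_utility c \<sigma> (?x p)))) (at p)" .
  then have "(dual_function c \<sigma> w has_derivative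
      (\<lambda>q. - (J q \<bullet> - marginal_utility c \<sigma> (?x p)))) (at p)"
    by (rule has_derivative_transform_within_open[OF _ open_pos_orthant p]) (simp add: X(4))
  moreover have "- (J q \<bullet> - marginal_utility c \<sigma> (?x p)) = q \<bullet> (- ?\<mu>) *\<^sub>R ?x p" for q
    unfolding X(2)[OF p] using budget[of q] by (simp add: inner_commute)
  ultimately show ?thesis unfolding gderiv_def by simp
qed

theorem theorem6p1:
  fixes c :: "real ^ 'n" and w \<sigma> :: real
  assumes "c \<in> nonneg_orthant" and "c \<noteq> 0" and "w > 0" and "\<sigma> > 0"
  shows "(\<forall>p \<in> pos_orthant.
            \<exists>!x. is_arg_max (utility_objective c \<sigma>) (\<lambda>x. x \<in> budget_set w p) x) \<and>
         SLC_function (neg_log_utility c \<sigma>) \<and>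
         SLC_function (dual_function c \<sigma> w) \<and>
         SLC_mapping (best_response c \<sigma> w)"
proof (intro conjI ballI)
  show "SLC_mapping (best_response c \<sigma> w)"
    using SLC_mapping_best_response assms by blast
  then show "SLC_function (dual_function c \<sigma> w)"
    using GDERIV_dual_function[OF assms(1,2,4,3)]
    by (intro SLC_function_of_gradient[OF _ SLC_mapping_scaleR])
  have "SLC_mapping (\<lambda>x. - marginal_utility c \<sigma> x)"
    using SLC_mapping_scaleR[OF SLC_mapping_marginal_utility[OF assms(1,2,4)], of "- 1"] by simp
  then show "SLC_function (neg_log_utility c \<sigma>)"
    using GDERIV_neg_log_utility[OF assms(1,2)] by (intro SLC_function_of_gradient)
  show "\<exists>!x. is_arg_max (utility_objective c \<sigma>) (\<lambda>x. x \<in> budget_set w p) x"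
    if "p \<in> pos_orthant" for p
    using unique_maximizer[OF assms(1,2,4,3) that] .
qed

end
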